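(* Let $X$ and $Y$ have finite alphabets $\mathcal X$ and $\mathcal Y$ and joint pmf $p_{X,Y}(x,y)$. To compute $G(X;Y)$ it suffices to consider $W$ with cardinality $|\mathcal W|\le|\mathcal X||\mathcal Y|$; that is, the minimum of $H(W)$ over all discrete $W$ with $X\to W\to Y$ equals the minimum over those $W$ whose alphabet $\mathcal W$ satisfies in addition $|\mathcal W|\le|\mathcal X||\mathcal Y|$.
   Context: $H$ denotes Shannon entropy. $X\to W\to Y$ means that $X$ and $Y$ are conditionally independent given $W$, where $W$ is a discrete random variable jointly distributed with $(X,Y)$ and the joint pmf of $(X,Y)$ is fixed. The common entropy is $G(X;Y)=\min_{W:\,X\to W\to Y}H(W)$. *)

theory Defs
  imports "HOL-Probability.Probability"
begin

text \<open>
  Entropy of a discrete distribution, in bits, as the expectation of \<open>- log 2 (pmf q W)\<close>.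
  A distribution with countably infinite support may have infinite entropy, so the value lies in
  \<open>[0, \<infinity>]\<close>; the library's real-valued \<open>entropy\<close> would return 0 in that case.
  Lemma \<open>pmf_entropy_eq_entropy\<close> below shows that the two agree whenever the entropy is finite.
\<close>

definition pmf_entropy :: "'w pmf \<Rightarrow> ennreal" where
  "pmf_entropy q = (\<integral>\<^sup>+ w. ennreal (- log 2 (pmf q w)) \<partial>measure_pmf q)"

text \<open>
  \<open>r\<close> is the joint distribution of \<open>((X, Y), W)\<close>. Given \<open>W = w\<close>, for every \<open>w\<close> of positive
  probability, the conditional law of \<open>(X, Y)\<close> is the product of its marginals:
  \<open>X \<rightarrow> W \<rightarrow> Y\<close>.
\<close>

definition cond_law :: "(('a \<times> 'b) \<times> 'w) pmf \<Rightarrow> 'w \<Rightarrow> ('a \<times> 'b) pmf" where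
  "cond_law r w = map_pmf fst (cond_pmf r {z. snd z = w})"

definition markov :: "(('a \<times> 'b) \<times> 'w) pmf \<Rightarrow> bool" where
  "markov r \<longleftrightarrow> (\<forall>w\<in>set_pmf (map_pmf snd r).
     cond_law r w = pair_pmf (map_pmf fst (cond_law r w)) (map_pmf snd (cond_law r w)))"

text \<open>
  All ways of adjoining to \<open>(X, Y) \<sim> p\<close> a discrete random variable \<open>W\<close> with
  \<open>X \<rightarrow> W \<rightarrow> Y\<close>.
\<close>

definition markov_couplings :: "('a \<times> 'b) pmf \<Rightarrow> (('a \<times> 'b) \<times> 'w) pmf set" where
  "markov_couplings p = {r. map_pmf fst r = p \<and> markov r}"

text \<open>
  The achievable values of \<open>H(W)\<close>. Every discrete \<open>W\<close> has countable support and can be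
  relabelled injectively by natural numbers without changing \<open>H(W)\<close> or the conditional independence
  (lemmas \<open>pmf_entropy_in_entropy_values\<close> and
  \<open>pmf_entropy_in_entropy_values_card_le\<close> below), so \<open>W\<close> is taken to be
  \<open>nat\<close>-valued.
\<close>

definition entropy_values :: "('a \<times> 'b) pmf \<Rightarrow> ennreal set" where
  "entropy_values p =
     {pmf_entropy (map_pmf snd r) |r :: (('a \<times> 'b) \<times> nat) pmf. r \<in> markov_couplings p}"

definition common_entropy :: "('a \<times> 'b) pmf \<Rightarrow> ennreal" where
  "common_entropy p = (LEAST h. h \<in> entropy_values p)"

text \<open>The values achievable with some alphabet \<open>S\<close> of \<open>W\<close> having at most \<open>n\<close> elements.\<close>

definition entropy_values_card_le :: "nat \<Rightarrow> ('a \<times> 'b) pmf \<Rightarrow> ennreal set" where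
  "entropy_values_card_le n p =
     {pmf_entropy (map_pmf snd r) |(r :: (('a \<times> 'b) \<times> nat) pmf) S.
        r \<in> markov_couplings p \<and> set_pmf (map_pmf snd r) \<subseteq> S \<and> finite S \<and> card S \<le> n}"

text \<open>\<open>m = min S\<close>, including that the minimum is attained (\<open>S\<close> may be infinite).\<close>

definition is_minimum :: "'c::order \<Rightarrow> 'c set \<Rightarrow> bool" where
  "is_minimum m S \<longleftrightarrow> m \<in> S \<and> (\<forall>s\<in>S. m \<le> s)"

lemma pmf_entropy_eq_entropy:
  assumes "pmf_entropy q < \<infinity>"
  shows "pmf_entropy q =
    ennreal (prob_space.entropy (measure_pmf q) 2 (count_space UNIV) (\<lambda>w. w))"
proof -
  interpret Q: information_space "measure_pmf q" 2
    by unfold_locales simp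
  have "distributed (measure_pmf q) (count_space UNIV) (\<lambda>w. w) (\<lambda>w. ennreal (pmf q w))"
    unfolding distributed_def
    by (auto simp: measure_pmf_eq_density[symmetric] distr_id2)
  then have "prob_space.entropy (measure_pmf q) 2 (count_space UNIV) (\<lambda>w. w)
      = - (\<integral>w. pmf q w * log 2 (pmf q w) \<partial>count_space UNIV)"
    by (rule Q.entropy_distr) simp
  also have "\<dots> = (\<integral>w. - log 2 (pmf q w) \<partial>measure_pmf q)"
    unfolding measure_pmf_eq_density[of q] by (subst integral_density) auto
  finally have eq: "prob_space.entropy (measure_pmf q) 2 (count_space UNIV) (\<lambda>w. w)
      = (\<integral>w. - log 2 (pmf q w) \<partial>measure_pmf q)" .
  have nn: "AE w in measure_pmf q. 0 \<le> - log 2 (pmf q w)"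
    by (auto simp: AE_measure_pmf_iff pmf_positive pmf_le_1)
  have "integrable (measure_pmf q) (\<lambda>w. - log 2 (pmf q w))"
    using assms nn by (intro integrableI_nonneg) (auto simp: pmf_entropy_def)
  from nn_integral_eq_integral[OF this nn] show ?thesis
    by (simp add: pmf_entropy_def eq)
qed

lemma cond_pmf_cong_support:
  assumes "set_pmf r \<inter> A = set_pmf r \<inter> B" "set_pmf r \<inter> A \<noteq> {}"
  shows "cond_pmf r A = cond_pmf r B"
proof (rule pmf_eqI)
  fix x
  have m: "measure r A = measure r B"
    using assms(1) by (metis inf_commute measure_Int_set_pmf)
  have B: "set_pmf r \<inter> B \<noteq> {}"
    using assms by simp
  show "pmf (cond_pmf r A) x = pmf (cond_pmf r B) x"
  proof (cases "x \<in> set_pmf r")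
    case True
    then have "x \<in> A \<longleftrightarrow> x \<in> B" using assms(1) by blast
    then show ?thesis by (simp add: pmf_cond[OF assms(2)] pmf_cond[OF B] m)
  next
    case False
    then have "pmf r x = 0" by (simp add: pmf_eq_0_set_pmf)
    then show ?thesis by (simp add: pmf_cond[OF assms(2)] pmf_cond[OF B])
  qed
qed

lemma pmf_entropy_map_inj_on:
  assumes "inj_on f (set_pmf q)"
  shows "pmf_entropy (map_pmf f q) = pmf_entropy q"
  unfolding pmf_entropy_def using assms
  by (auto intro!: nn_integral_cong_AE simp: AE_measure_pmf_iff pmf_map_inj)

lemma cond_law_relabel:
  fixes r :: "(('a \<times> 'b) \<times> 'w) pmf"
  assumes inj: "inj_on f (set_pmf (map_pmf snd r))" and w: "w \<in> set_pmf (map_pmf snd r)"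
  shows "cond_law (map_pmf (map_prod id f) r) (f w) = cond_law r w"
proof -
  let ?g = "map_prod id f :: ('a \<times> 'b) \<times> 'w \<Rightarrow> _"
  obtain z where z: "z \<in> set_pmf r" "snd z = w" using w by auto
  have ne: "set_pmf r \<inter> {z. snd z = w} \<noteq> {}" using z by blast
  have "set_pmf r \<inter> (?g -` {z. snd z = f w}) \<noteq> {}" using z by auto
  then have "cond_pmf (map_pmf ?g r) {z. snd z = f w}
      = map_pmf ?g (cond_pmf r (?g -` {z. snd z = f w}))"
    by (rule cond_map_pmf)
  also have "cond_pmf r (?g -` {z. snd z = f w}) = cond_pmf r {z. snd z = w}"
  proof (rule cond_pmf_cong_support[symmetric])
    show "set_pmf r \<inter> {z. snd z = w} = set_pmf r \<inter> (?g -` {z. snd z = f w})"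
    proof (intro set_eqI iffI)
      fix y assume y: "y \<in> set_pmf r \<inter> (?g -` {z. snd z = f w})"
      then have "f (snd y) = f w" "snd y \<in> set_pmf (map_pmf snd r)" by auto
      then have "snd y = w" using inj w by (meson inj_onD)
      then show "y \<in> set_pmf r \<inter> {z. snd z = w}" using y by simp
    qed auto
  qed (rule ne)
  finally have eq: "cond_pmf (map_pmf ?g r) {z. snd z = f w}
      = map_pmf ?g (cond_pmf r {z. snd z = w})" .
  show ?thesis
    unfolding cond_law_def eq by (simp add: map_pmf_comp)
qed

lemma markov_couplings_relabel:
  assumes "r \<in> markov_couplings p" "inj_on f (set_pmf (map_pmf snd r))"
  shows "map_pmf (map_prod id f) r \<in> markov_couplings p"
  using assms by (auto simp: markov_couplings_def markov_def map_pmf_comp cond_law_relabel)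

lemma pmf_entropy_in_entropy_values:
  fixes r :: "(('a \<times> 'b) \<times> 'w) pmf"
  assumes "r \<in> markov_couplings p"
  shows "pmf_entropy (map_pmf snd r) \<in> entropy_values p"
proof -
  let ?f = "to_nat_on (set_pmf (map_pmf snd r))"
  have inj: "inj_on ?f (set_pmf (map_pmf snd r))"
    by (rule inj_on_to_nat_on) (rule countable_set_pmf)
  have "map_pmf snd (map_pmf (map_prod id ?f) r) = map_pmf ?f (map_pmf snd r)"
    by (simp add: map_pmf_comp)
  then have "pmf_entropy (map_pmf snd r) = pmf_entropy (map_pmf snd (map_pmf (map_prod id ?f) r))"
    using pmf_entropy_map_inj_on[OF inj] by simp
  with markov_couplings_relabel[OF assms inj] show ?thesis
    unfolding entropy_values_def by blast
qed

lemma pmf_entropy_in_entropy_values_card_le: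
  fixes r :: "(('a \<times> 'b) \<times> 'w) pmf"
  assumes "r \<in> markov_couplings p" "set_pmf (map_pmf snd r) \<subseteq> S" "finite S" "card S \<le> n"
  shows "pmf_entropy (map_pmf snd r) \<in> entropy_values_card_le n p"
proof -
  let ?f = "to_nat_on S"
  let ?r = "map_pmf (map_prod id ?f) r"
  have inj: "inj_on ?f (set_pmf (map_pmf snd r))"
    using assms(2,3) by (meson countable_finite inj_on_subset inj_on_to_nat_on)
  have eq: "map_pmf snd ?r = map_pmf ?f (map_pmf snd r)"
    by (simp add: map_pmf_comp)
  have "pmf_entropy (map_pmf snd r) = pmf_entropy (map_pmf snd ?r)"
    using pmf_entropy_map_inj_on[OF inj] eq by simp
  moreover have "set_pmf (map_pmf snd ?r) \<subseteq> ?f ` S"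
    using assms(2) by auto
  moreover have "card (?f ` S) \<le> n"
    using assms(3,4) card_image_le order_trans by blast
  ultimately show ?thesis
    using markov_couplings_relabel[OF assms(1) inj] assms(3)
    unfolding entropy_values_card_le_def by blast
qed

end

theory Submission
  imports Defs "HOL-Real_Asymp.Real_Asymp"
begin

text \<open>
  A coupling \<open>r\<close> is Markov iff all \<open>2 \<times> 2\<close> minors of the matrices \<open>r (\<cdot>, w)\<close> vanish. This is a closed
  condition, so over a fixed finite alphabet the entropy attains its minimum by compactness. It is
  also preserved by rescaling the matrices; if there are more than \<open>|A| |B|\<close> of them, they are linearly
  dependent, and moving the weights along a dependency on which the entropy has nonpositive
  derivative removes an atom without increasing the entropy, by concavity. For infinite \<open>W\<close>, replace
  \<open>W\<close> by \<open>(X, Y)\<close> on the event \<open>W \<ge> N\<close>: this is again a Markov coupling, has finite support, and its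
  entropy exceeds that of \<open>W\<close> by an error that vanishes as \<open>N\<close> grows.
\<close>

section \<open>The entropy summand and entropies as finite sums\<close>

definition eta :: "real \<Rightarrow> real" where
  "eta x = - x * log 2 x"

lemma eta_0 [simp]: "eta 0 = 0"
  by (simp add: eta_def)

lemma eta_nonneg: "0 \<le> x \<Longrightarrow> x \<le> 1 \<Longrightarrow> 0 \<le> eta x"
  by (cases "x = 0") (auto simp: eta_def mult_le_0_iff)

text \<open>At 0 this is the limit of \<open>x * ln x\<close> from the right. The endpoint matters:
  weights of atoms may vanish in the compactness argument, and tail masses tend to 0 in the
  truncation.\<close>

lemma continuous_on_eta: "continuous_on {0..} eta"
  unfolding continuous_on_def
proof
  fix x :: real assume "x \<in> {0..}"
  then consider "x = 0" | "x > 0" by fastforce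
  then show "(eta \<longlongrightarrow> eta x) (at x within {0..})"
  proof cases
    case 1
    have "((\<lambda>x::real. - x * (ln x / ln 2)) \<longlongrightarrow> 0) (at_right 0)"
      by real_asymp
    then have "(eta \<longlongrightarrow> 0) (at_right 0)"
      by (simp add: eta_def[abs_def] log_def)
    then show ?thesis
      using 1 by (simp add: at_within_Ici_at_right)
  next
    case 2
    then have "((\<lambda>x. - x * log 2 x) \<longlongrightarrow> - x * log 2 x) (at x within {0..})"
      by (intro tendsto_intros) auto
    then show ?thesis by (simp add: eta_def[abs_def])
  qed
qed

text \<open>Concavity in tangent form: as a function of \<open>g\<close>, the right-hand side is the
  tangent of \<open>eta (g * q)\<close> at \<open>g = 1\<close>. It comes from
  \<open>ln u \<le> u - 1\<close> with \<open>u = 1 / g\<close>; the value \<open>g = 0\<close>, at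
  which an atom disappears, is included.\<close>

lemma eta_scale_le:
  assumes "0 \<le> g" "0 < q"
  shows "eta (g * q) \<le> g * eta q + q * (1 - g) / ln 2"
proof (cases "g = 0")
  case False
  with assms have g: "g > 0" by simp
  have "ln (1 / g) \<le> 1 / g - 1"
    using g by (intro ln_le_minus_one) simp
  then have "g * - ln g \<le> g * (1 / g - 1)"
    using g by (intro mult_left_mono) (auto simp: ln_div)
  then have "q * (g * - ln g) / ln 2 \<le> q * (1 - g) / ln 2"
    using g assms by (intro divide_right_mono mult_left_mono) (auto simp: algebra_simps)
  moreover have "eta (g * q) = g * eta q + q * (g * - ln g) / ln 2"
    using g assms by (simp add: eta_def log_def ln_mult field_simps)
  ultimately show ?thesis by simp
qed (use assms in auto)

lemma ennreal_eta_pmf: "ennreal (eta (pmf q w)) = ennreal (- log 2 (pmf q w)) * pmf q w"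
  by (cases "pmf q w = 0")
    (auto simp: eta_def pmf_le_1 pmf_nonneg order_less_le ennreal_mult'[symmetric] mult.commute)

lemma pmf_entropy_finite_support:
  assumes "finite S" "set_pmf q \<subseteq> S"
  shows "pmf_entropy q = ennreal (\<Sum>w\<in>S. eta (pmf q w))"
proof -
  have "pmf_entropy q = (\<Sum>w\<in>S. ennreal (- log 2 (pmf q w)) * pmf q w)"
    unfolding pmf_entropy_def using assms by (intro nn_integral_measure_pmf_support) auto
  also have "\<dots> = (\<Sum>w\<in>S. ennreal (eta (pmf q w)))"
    by (simp add: ennreal_eta_pmf)
  also have "\<dots> = ennreal (\<Sum>w\<in>S. eta (pmf q w))"
    by (intro sum_ennreal eta_nonneg) (auto simp: pmf_le_1)
  finally show ?thesis .
qed

text \<open>Restricting the integral to \<open>S\<close> drops only nonnegative terms. This bounds a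
  possibly infinite entropy from below by the atoms that truncation keeps.\<close>

lemma pmf_entropy_ge_partial_sum:
  assumes "finite S"
  shows "ennreal (\<Sum>w\<in>S. eta (pmf q w)) \<le> pmf_entropy q"
proof -
  have "ennreal (\<Sum>w\<in>S. eta (pmf q w)) = (\<Sum>w\<in>S. ennreal (eta (pmf q w)))"
    by (intro sum_ennreal[symmetric] eta_nonneg) (auto simp: pmf_le_1)
  also have "\<dots> = (\<Sum>w\<in>S. ennreal (- log 2 (pmf q w)) * pmf q w)"
    by (simp add: ennreal_eta_pmf)
  also have "\<dots> = (\<Sum>w\<in>S. (ennreal (- log 2 (pmf q w)) * indicator S w) * pmf q w)"
    by (intro sum.cong) auto
  also have "\<dots> = (\<integral>\<^sup>+ w. ennreal (- log 2 (pmf q w)) * indicator S w \<partial>measure_pmf q)"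
    using assms by (intro nn_integral_measure_pmf_support[symmetric]) auto
  also have "\<dots> \<le> pmf_entropy q"
    unfolding pmf_entropy_def by (intro nn_integral_mono) (auto split: split_indicator)
  finally show ?thesis .
qed

section \<open>Finitely supported couplings as matrices\<close>

text \<open>Turns a matrix back into a coupling, both for the rescaled matrices and for the
  minimizer found by compactness.\<close>

lemma ex_pmf_eq_finite_support:
  assumes "\<And>x. 0 \<le> f x" "finite J" "\<And>x. x \<notin> J \<Longrightarrow> f x = 0" "(\<Sum>x\<in>J. f x) = 1"
  shows "\<exists>r. \<forall>x. pmf r x = f x"
proof -
  have "(\<integral>\<^sup>+x. ennreal (f x) \<partial>count_space UNIV) = (\<Sum>x\<in>J. ennreal (f x))"
    using assms by (intro nn_integral_count_space') auto
  also have "\<dots> = 1"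
    using assms by simp
  finally show ?thesis
    using pmf_embed_pmf[of f] assms(1) by blast
qed

lemma pmf_map_fst_eq_sum:
  assumes "finite S" "set_pmf (map_pmf snd r) \<subseteq> S"
  shows "pmf (map_pmf fst r) z = (\<Sum>w\<in>S. pmf r (z, w))"
proof -
  have "fst -` {z} \<inter> set_pmf r = (Pair z ` S) \<inter> set_pmf r"
    using assms(2) by force
  then have "measure r (fst -` {z}) = measure r (Pair z ` S)"
    by (metis measure_Int_set_pmf)
  also have "\<dots> = (\<Sum>w\<in>S. pmf r (z, w))"
    using assms(1) by (simp add: measure_measure_pmf_finite sum.reindex inj_on_def)
  finally show ?thesis by (simp add: pmf_map)
qed

lemma pmf_map_snd_eq_sum:
  assumes "finite C" "set_pmf (map_pmf fst r) \<subseteq> C"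
  shows "pmf (map_pmf snd r) w = (\<Sum>z\<in>C. pmf r (z, w))"
proof -
  have "snd -` {w} \<inter> set_pmf r = ((\<lambda>z. (z, w)) ` C) \<inter> set_pmf r"
    using assms(2) by force
  then have "measure r (snd -` {w}) = measure r ((\<lambda>z. (z, w)) ` C)"
    by (metis measure_Int_set_pmf)
  also have "\<dots> = (\<Sum>z\<in>C. pmf r (z, w))"
    using assms(1) by (simp add: measure_measure_pmf_finite sum.reindex inj_on_def)
  finally show ?thesis by (simp add: pmf_map)
qed

section \<open>Conditional independence as vanishing of minors\<close>

text \<open>For the converse direction, swapping the second coordinates of two independent copies of
  \<open>\<mu>\<close> leaves their joint law invariant.\<close>

lemma pmf_eq_pair_marginals_iff:
  fixes \<mu> :: "('a \<times> 'b) pmf"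
  shows "\<mu> = pair_pmf (map_pmf fst \<mu>) (map_pmf snd \<mu>) \<longleftrightarrow>
    (\<forall>x y x' y'. pmf \<mu> (x, y) * pmf \<mu> (x', y') = pmf \<mu> (x, y') * pmf \<mu> (x', y))"
    (is "_ \<longleftrightarrow> ?minors")
proof
  assume "\<mu> = pair_pmf (map_pmf fst \<mu>) (map_pmf snd \<mu>)"
  then have "pmf \<mu> (x, y) = pmf (map_pmf fst \<mu>) x * pmf (map_pmf snd \<mu>) y" for x y
    by (metis pmf_pair)
  then show ?minors by simp
next
  assume minors: ?minors
  define s :: "('a \<times> 'b) \<times> ('a \<times> 'b) \<Rightarrow> ('a \<times> 'b) \<times> ('a \<times> 'b)"
    where "s = (\<lambda>(z, z'). ((fst z, snd z'), (fst z', snd z)))"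
  have ss: "s (s u) = u" for u
    by (simp add: s_def split: prod.splits)
  have inj: "inj s"
    by (metis injI ss)
  have "map_pmf s (pair_pmf \<mu> \<mu>) = pair_pmf \<mu> \<mu>"
  proof (rule pmf_eqI)
    fix u
    have "pmf (map_pmf s (pair_pmf \<mu> \<mu>)) u = pmf (map_pmf s (pair_pmf \<mu> \<mu>)) (s (s u))"
      by (simp add: ss)
    also have "\<dots> = pmf (pair_pmf \<mu> \<mu>) (s u)"
      by (rule pmf_map_inj'[OF inj])
    also have "\<dots> = pmf (pair_pmf \<mu> \<mu>) u"
      using minors by (cases u) (auto simp: s_def pmf_pair)
    finally show "pmf (map_pmf s (pair_pmf \<mu> \<mu>)) u = pmf (pair_pmf \<mu> \<mu>) u" .
  qed
  then have "\<mu> = map_pmf fst (map_pmf s (pair_pmf \<mu> \<mu>))"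
    by (simp add: map_fst_pair_pmf)
  also have "\<dots> = map_pmf (\<lambda>(z, z'). (fst z, snd z')) (pair_pmf \<mu> \<mu>)"
    unfolding map_pmf_comp by (intro map_pmf_cong) (auto simp: s_def)
  also have "\<dots> = pair_pmf (map_pmf fst \<mu>) (map_pmf snd \<mu>)"
    by (rule map_pair)
  finally show "\<mu> = pair_pmf (map_pmf fst \<mu>) (map_pmf snd \<mu>)" .
qed

lemma pmf_cond_law:
  assumes "w \<in> set_pmf (map_pmf snd r)"
  shows "pmf (cond_law r w) z = pmf r (z, w) / pmf (map_pmf snd r) w"
proof -
  let ?c = "cond_pmf r {z. snd z = w}"
  have ne: "set_pmf r \<inter> {z. snd z = w} \<noteq> {}"
    using assms by auto
  have "fst -` {z} \<inter> set_pmf ?c = {(z, w)} \<inter> set_pmf ?c"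
    using set_cond_pmf[OF ne] by auto
  then have "measure ?c (fst -` {z}) = measure ?c {(z, w)}"
    by (metis measure_Int_set_pmf)
  then show ?thesis
    by (simp add: cond_law_def pmf_map measure_pmf_single pmf_cond[OF ne] vimage_def)
qed

text \<open>The squared probability of \<open>w\<close> cancels from the minors of the conditional
  law. For \<open>w\<close> of probability zero all entries vanish, so the condition may be asked of
  every \<open>w\<close> and becomes a system of homogeneous quadratic equations in the entries of
  \<open>r\<close>.\<close>

lemma markov_iff_minors:
  "markov r \<longleftrightarrow> (\<forall>w x y x' y'.
     pmf r ((x, y), w) * pmf r ((x', y'), w) = pmf r ((x, y'), w) * pmf r ((x', y), w))"
proof -
  have "cond_law r w = pair_pmf (map_pmf fst (cond_law r w)) (map_pmf snd (cond_law r w)) \<longleftrightarrow>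
    (\<forall>x y x' y'.
     pmf r ((x, y), w) * pmf r ((x', y'), w) = pmf r ((x, y'), w) * pmf r ((x', y), w))"
    if w: "w \<in> set_pmf (map_pmf snd r)" for w
  proof -
    have "pmf (map_pmf snd r) w \<noteq> 0"
      using w by (meson pmf_eq_0_set_pmf)
    then show ?thesis
      unfolding pmf_eq_pair_marginals_iff pmf_cond_law[OF w] by (simp add: field_simps)
  qed
  moreover have "pmf r (z, w) = 0" if "w \<notin> set_pmf (map_pmf snd r)" for w z
    using that by (force simp: pmf_eq_0_set_pmf)
  ultimately show ?thesis
    unfolding markov_def by (metis mult_zero_left)
qed

section \<open>Reducing a finite alphabet of W\<close>

text \<open>Gaussian elimination, one coordinate at a time. The vectors form a family indexed by
  \<open>S\<close>, so equal vectors at different indices also count as dependent.\<close>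

lemma ex_nontrivial_dependency:
  fixes a :: "'w \<Rightarrow> 'c \<Rightarrow> 'k::field"
  assumes "finite C" "finite S" "card C < card S"
  shows "\<exists>c. (\<exists>w\<in>S. c w \<noteq> 0) \<and> (\<forall>z\<in>C. (\<Sum>w\<in>S. c w * a w z) = 0)"
  using assms
proof (induction C arbitrary: S a rule: finite_induct)
  case empty
  then have "S \<noteq> {}" by auto
  then show ?case by (intro exI[of _ "\<lambda>_. 1"]) auto
next
  case (insert x C)
  show ?case
  proof (cases "\<forall>w\<in>S. a w x = 0")
    case True
    then show ?thesis
      using insert.IH[of S a] insert.prems insert.hyps by auto
  next
    case False
    then obtain v where v: "v \<in> S" "a v x \<noteq> 0" by blast
    \<comment> \<open>Subtracting a multiple of the pivot vector \<open>a v\<close> clears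
      coordinate \<open>x\<close>, leaving one vector and one coordinate fewer.\<close>
    define b where "b w z = a w z - a w x / a v x * a v z" for w z
    have "card C < card (S - {v})"
      using insert.prems insert.hyps v by simp
    then obtain c where c: "\<exists>w\<in>S - {v}. c w \<noteq> 0" "\<forall>z\<in>C. (\<Sum>w\<in>S - {v}. c w * b w z) = 0"
      using insert.IH[of "S - {v}" b] insert.prems by auto
    \<comment> \<open>The coefficient of the pivot collects all the multiples that were
      subtracted.\<close>
    define d where "d = c(v := - (\<Sum>w\<in>S - {v}. c w * a w x) / a v x)"
    have d: "(\<Sum>w\<in>S. d w * a w z) = (\<Sum>w\<in>S - {v}. c w * b w z)" for z
    proof -
      have "(\<Sum>w\<in>S. d w * a w z) = d v * a v z + (\<Sum>w\<in>S - {v}. c w * a w z)"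
        using v insert.prems by (simp add: sum.remove d_def)
      also have "d v * a v z = - (\<Sum>w\<in>S - {v}. c w * (a w x / a v x * a v z))"
        by (simp add: d_def sum_distrib_left sum_divide_distrib mult_ac)
      finally show ?thesis
        by (simp add: b_def right_diff_distrib sum_subtractf)
    qed
    have "(\<Sum>w\<in>S. d w * a w x) = 0"
      unfolding d using v by (simp add: b_def)
    moreover have "\<exists>w\<in>S. d w \<noteq> 0"
      using c(1) by (auto simp: d_def)
    ultimately show ?thesis
      using c(2) d by (intro exI[of _ d]) auto
  qed
qed

lemma markov_coupling_support_reduction_step:
  fixes r :: "(('a \<times> 'b) \<times> 'w) pmf"
  assumes r: "r \<in> markov_couplings p" and C: "finite C" "set_pmf p \<subseteq> C"
    and fin: "finite (set_pmf (map_pmf snd r))"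
    and card: "card C < card (set_pmf (map_pmf snd r))"
  shows "\<exists>r'\<in>markov_couplings p. set_pmf (map_pmf snd r') \<subset> set_pmf (map_pmf snd r) \<and>
    pmf_entropy (map_pmf snd r') \<le> pmf_entropy (map_pmf snd r)"
proof -
  define S where "S = set_pmf (map_pmf snd r)"
  define q where "q = pmf (map_pmf snd r)"
  have finS: "finite S" and S_le: "set_pmf (map_pmf snd r) \<subseteq> S"
    using fin by (auto simp: S_def)
  have fst_r: "map_pmf fst r = p" and mk: "markov r"
    using r by (auto simp: markov_couplings_def)
  have q_pos: "q w > 0" if "w \<in> S" for w
    using that by (simp only: S_def q_def pmf_positive)
  have q_sum: "q w = (\<Sum>z\<in>C. pmf r (z, w))" for w
    unfolding q_def using C fst_r by (intro pmf_map_snd_eq_sum) auto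
  have p_sum: "pmf p z = (\<Sum>w\<in>S. pmf r (z, w))" for z
    using pmf_map_fst_eq_sum[OF finS S_le] fst_r by simp
  have r_out: "pmf r (z, w) = 0" if "z \<notin> C \<or> w \<notin> S" for z w
    using that C fst_r by (force simp: pmf_eq_0_set_pmf S_def)
  have "\<exists>c. (\<exists>w\<in>S. c w \<noteq> 0) \<and> (\<forall>z\<in>C. (\<Sum>w\<in>S. c w * pmf r (z, w)) = 0)"
    using card finS C by (intro ex_nontrivial_dependency) (auto simp: S_def)
  then obtain c0 where c0: "\<exists>w\<in>S. c0 w \<noteq> 0"
      "\<And>z. z \<in> C \<Longrightarrow> (\<Sum>w\<in>S. c0 w * pmf r (z, w)) = 0"
    by blast
  txt \<open>Replacing the dependency by its negative if necessary, the derivative of the entropy in its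
    direction is nonpositive.\<close>
  define \<sigma> :: real where "\<sigma> = (if (\<Sum>w\<in>S. c0 w * eta (q w)) \<le> 0 then 1 else - 1)"
  define c where "c w = \<sigma> * c0 w" for w
  have c_sum: "(\<Sum>w\<in>S. c w * u w) = \<sigma> * (\<Sum>w\<in>S. c0 w * u w)" for u
    by (simp add: c_def sum_distrib_left mult.assoc)
  have c_nz: "\<exists>w\<in>S. c w \<noteq> 0"
    using c0(1) by (auto simp: c_def \<sigma>_def)
  have c_dep: "(\<Sum>w\<in>S. c w * pmf r (z, w)) = 0" for z
    using c0(2)[of z] r_out[of z] by (cases "z \<in> C") (auto simp: c_sum)
  have c_eta: "(\<Sum>w\<in>S. c w * eta (q w)) \<le> 0"
    by (auto simp: c_sum \<sigma>_def)
  \<comment> \<open>The dependency summed over all \<open>z\<close>: the total mass is kept, and the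
    \<open>1 / ln 2\<close> term of the tangent bound will cancel.\<close>
  have c_q: "(\<Sum>w\<in>S. c w * q w) = 0"
  proof -
    have "(\<Sum>w\<in>S. c w * q w) = (\<Sum>w\<in>S. \<Sum>z\<in>C. c w * pmf r (z, w))"
      by (simp add: q_sum sum_distrib_left)
    also have "\<dots> = (\<Sum>z\<in>C. \<Sum>w\<in>S. c w * pmf r (z, w))"
      by (rule sum.swap)
    finally show ?thesis by (simp add: c_dep)
  qed
  \<comment> \<open>A nonzero \<open>c\<close> whose sum with positive weights \<open>q\<close>
    vanishes must take a negative value.\<close>
  have neg: "\<exists>w\<in>S. c w < 0"
  proof (rule ccontr)
    assume "\<not> (\<exists>w\<in>S. c w < 0)"
    then have "\<forall>w\<in>S. 0 \<le> c w * q w"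
      using q_pos by (simp add: not_less less_imp_le)
    then have "\<forall>w\<in>S. c w * q w = 0"
      using sum_nonneg_eq_0_iff[OF finS, of "\<lambda>w. c w * q w"] c_q by auto
    then show False using c_nz q_pos by force
  qed
  then have "S \<noteq> {}" by auto
  then obtain v where v: "v \<in> S" and v_min: "\<And>w. w \<in> S \<Longrightarrow> c v \<le> c w"
    using finS by (meson arg_min_if_finite(1) arg_min_least)
  have cv: "c v < 0"
    using neg v_min by (meson le_less_trans)
  \<comment> \<open>The largest step that keeps every factor \<open>g w\<close> nonnegative. The
    most negative coefficient \<open>c v\<close> reaches zero first, which removes
    \<open>v\<close>.\<close>
  define t where "t = - 1 / c v"
  define g where "g w = 1 + t * c w" for w
  have t: "t > 0" using cv by (simp add: t_def)
  have gv: "g v = 0" using cv by (simp add: g_def t_def)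
  have g_nn: "g w \<ge> 0" if "w \<in> S" for w
    using mult_left_mono[OF v_min[OF that], of t] t gv unfolding g_def by linarith
  define f where "f = (\<lambda>(z, w). g w * pmf r (z, w))"
  have f_sum: "(\<Sum>w\<in>S. f (z, w)) = pmf p z" for z
  proof -
    have "(\<Sum>w\<in>S. f (z, w)) = (\<Sum>w\<in>S. pmf r (z, w)) + t * (\<Sum>w\<in>S. c w * pmf r (z, w))"
      by (simp add: f_def g_def algebra_simps sum.distrib sum_distrib_left)
    then show ?thesis by (simp add: c_dep p_sum)
  qed
  have "\<exists>r'. \<forall>x. pmf r' x = f x"
  proof (rule ex_pmf_eq_finite_support)
    show "0 \<le> f x" for x
      using g_nn[of "snd x"] r_out[of "fst x" "snd x"]
      by (cases "snd x \<in> S") (auto simp: f_def case_prod_beta)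
    show "f x = 0" if "x \<notin> C \<times> S" for x
      using that r_out by (cases x) (auto simp: f_def)
    show "(\<Sum>x\<in>C \<times> S. f x) = 1"
      using C by (simp add: sum.cartesian_product' f_sum sum_pmf_eq_1)
  qed (use C finS in auto)
  then obtain r' where r': "\<And>z w. pmf r' (z, w) = g w * pmf r (z, w)"
    by (auto simp: f_def)
  have supp: "set_pmf (map_pmf snd r') \<subseteq> S - {v}"
  proof
    fix w assume "w \<in> set_pmf (map_pmf snd r')"
    then obtain z where "pmf r' (z, w) \<noteq> 0" by (force simp: set_pmf_iff)
    then show "w \<in> S - {v}" using gv r_out[of z w] by (auto simp: r')
  qed
  have fst_r': "map_pmf fst r' = p"
  proof (rule pmf_eqI)
    fix z
    have "pmf (map_pmf fst r') z = (\<Sum>w\<in>S. pmf r' (z, w))"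
      using supp by (intro pmf_map_fst_eq_sum finS) auto
    then show "pmf (map_pmf fst r') z = pmf p z"
      using f_sum[of z] by (simp add: r' f_def)
  qed
  have q': "pmf (map_pmf snd r') w = g w * q w" for w
    using pmf_map_snd_eq_sum[of C r' w] C fst_r' by (simp add: r' q_sum sum_distrib_left)
  have "markov r'"
    unfolding markov_iff_minors
  proof (intro allI)
    fix w x y x' y'
    have "pmf r ((x, y), w) * pmf r ((x', y'), w) = pmf r ((x, y'), w) * pmf r ((x', y), w)"
      using mk by (simp only: markov_iff_minors)
    from arg_cong[OF this, of "\<lambda>u. g w * g w * u"]
    show "pmf r' ((x, y), w) * pmf r' ((x', y'), w) = pmf r' ((x, y'), w) * pmf r' ((x', y), w)"
      by (simp only: r' mult_ac)
  qed
  \<comment> \<open>The tangent bound at each atom. Its sum is affine in \<open>t\<close> with slope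
    \<open>\<Sum>w\<in>S. c w * eta (q w)\<close>, which the choice of sign made
    nonpositive.\<close>
  have "(\<Sum>w\<in>S. eta (g w * q w)) \<le> (\<Sum>w\<in>S. g w * eta (q w) + q w * (1 - g w) / ln 2)"
    using g_nn q_pos by (intro sum_mono eta_scale_le) auto
  also have "\<dots> = (\<Sum>w\<in>S. eta (q w)) + t * (\<Sum>w\<in>S. c w * eta (q w)) - t * (\<Sum>w\<in>S. c w * q w) / ln 2"
    by (simp add: g_def algebra_simps sum.distrib sum_subtractf sum_distrib_left sum_divide_distrib)
  also have "\<dots> \<le> (\<Sum>w\<in>S. eta (q w))"
    using t c_eta by (simp add: c_q mult_le_0_iff)
  finally have le: "(\<Sum>w\<in>S. eta (g w * q w)) \<le> (\<Sum>w\<in>S. eta (q w))" .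
  \<comment> \<open>Both entropies are written as sums over the same \<open>S\<close>; the removed
    atom contributes \<open>eta 0 = 0\<close>.\<close>
  have supp_S: "set_pmf (map_pmf snd r') \<subseteq> S"
    using supp by blast
  have "pmf_entropy (map_pmf snd r') \<le> pmf_entropy (map_pmf snd r)"
    unfolding pmf_entropy_finite_support[OF finS supp_S] pmf_entropy_finite_support[OF finS S_le]
    using le by (simp add: q' q_def[symmetric] ennreal_leI)
  moreover have "set_pmf (map_pmf snd r') \<subset> set_pmf (map_pmf snd r)"
    using supp v unfolding S_def by blast
  moreover have "r' \<in> markov_couplings p"
    using \<open>markov r'\<close> fst_r' by (simp add: markov_couplings_def)
  ultimately show ?thesis by blast
qed

lemma markov_coupling_support_reduction:
  fixes r :: "(('a \<times> 'b) \<times> 'w) pmf"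
  assumes "r \<in> markov_couplings p" "finite C" "set_pmf p \<subseteq> C" "finite (set_pmf (map_pmf snd r))"
  shows "\<exists>r' :: (('a \<times> 'b) \<times> 'w) pmf\<in>markov_couplings p. finite (set_pmf (map_pmf snd r')) \<and>
    card (set_pmf (map_pmf snd r')) \<le> card C \<and>
    pmf_entropy (map_pmf snd r') \<le> pmf_entropy (map_pmf snd r)"
  using assms(1,4)
proof (induction "card (set_pmf (map_pmf snd r))" arbitrary: r rule: less_induct)
  case less
  show ?case
  proof (cases "card (set_pmf (map_pmf snd r)) \<le> card C")
    case True
    with less.prems show ?thesis by (meson order_refl)
  next
    case False
    then obtain r1 where r1: "r1 \<in> markov_couplings p"
        "set_pmf (map_pmf snd r1) \<subset> set_pmf (map_pmf snd r)"
        "pmf_entropy (map_pmf snd r1) \<le> pmf_entropy (map_pmf snd r)"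
      using markov_coupling_support_reduction_step[OF less.prems(1) assms(2,3) less.prems(2)]
      unfolding not_le by blast
    have "finite (set_pmf (map_pmf snd r1))"
      using r1(2) less.prems(2) by (meson finite_subset psubsetE)
    with less.hyps[OF psubset_card_mono[OF less.prems(2) r1(2)] r1(1)] r1(3) show ?thesis
      by (meson order_trans)
  qed
qed

section \<open>Attainment of the minimum over a fixed finite alphabet\<close>

text \<open>Tychonoff's theorem. The index type may be infinite, since only the sets
  \<open>C\<close> and \<open>T\<close>, not the types around them, will be finite.\<close>

lemma compact_product_space:
  fixes K :: "'i \<Rightarrow> ('c::topological_space) set"
  assumes "\<And>i. compact (K i)"
  shows "compact {M. \<forall>i. M i \<in> K i}"
proof -
  have "compactin (product_topology (\<lambda>i. euclidean) UNIV) (PiE UNIV K)"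
    unfolding compactin_PiE using assms by simp
  moreover have "PiE UNIV K = {M. \<forall>i. M i \<in> K i}"
    by (auto simp: PiE_def)
  ultimately show ?thesis
    by (simp add: euclidean_product_topology)
qed

text \<open>Couplings with alphabet inside \<open>T\<close> correspond to the points of a compact
  set of matrices on which the entropy is continuous; \<open>r1\<close> witnesses that this set is
  nonempty.\<close>

lemma ex_min_entropy_coupling_on_finite_alphabet:
  fixes r1 :: "(('a \<times> 'b) \<times> 'w) pmf"
  assumes C: "finite C" "set_pmf p \<subseteq> C" and T: "finite T"
    and r1: "r1 \<in> markov_couplings p" "set_pmf (map_pmf snd r1) \<subseteq> T"
  shows "\<exists>r0\<in>markov_couplings p. set_pmf (map_pmf snd r0) \<subseteq> T \<and>
    (\<forall>r\<in>markov_couplings p. set_pmf (map_pmf snd r) \<subseteq> T \<longrightarrow>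
      pmf_entropy (map_pmf snd r0) \<le> pmf_entropy (map_pmf snd r))"
proof -
  \<comment> \<open>Entries outside \<open>C \<times> T\<close> are pinned to 0, so that a limit
    matrix has finite support.\<close>
  define K where "K i = (if i \<in> C \<times> T then {0..1::real} else {0})" for i :: "('a \<times> 'b) \<times> 'w"
  define F where "F = {M. \<forall>i. M i \<in> K i} \<inter> ({M. \<forall>z. (\<Sum>w\<in>T. M (z, w)) = pmf p z} \<inter>
    {M. \<forall>w x y x' y'. M ((x, y), w) * M ((x', y'), w) = M ((x, y'), w) * M ((x', y), w)})"
  have F_nonneg: "0 \<le> M i" if "M \<in> F" for M i
  proof -
    have "M i \<in> K i" using that unfolding F_def by blast
    then show ?thesis by (auto simp: K_def split: if_splits)
  qed
  \<comment> \<open>The entropy of W as a function of the matrix: the inner sum is the probability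
    of \<open>w\<close>.\<close>
  define h where "h M = (\<Sum>w\<in>T. eta (\<Sum>z\<in>C. M (z, w)))" for M
  have "compact F"
    unfolding F_def
    by (intro compact_Int_closed compact_product_space closed_Int closed_Collect_all
        closed_Collect_eq continuous_intros continuous_on_product_coordinates) (auto simp: K_def)
  have F_pmf: "pmf r \<in> F" and h_pmf: "pmf_entropy (map_pmf snd r) = ennreal (h (pmf r))"
    if r: "r \<in> markov_couplings p" "set_pmf (map_pmf snd r) \<subseteq> T" for r
  proof -
    have fst_r: "map_pmf fst r = p" and mk: "markov r"
      using r by (auto simp: markov_couplings_def)
    have "pmf r (z, w) = 0" if "z \<notin> C \<or> w \<notin> T" for z w
      using that C r(2) fst_r by (force simp: pmf_eq_0_set_pmf)
    then show "pmf r \<in> F"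
      using mk pmf_map_fst_eq_sum[OF T r(2)] fst_r
      by (auto simp: F_def K_def pmf_le_1 markov_iff_minors)
    show "pmf_entropy (map_pmf snd r) = ennreal (h (pmf r))"
      using C fst_r by (simp add: pmf_entropy_finite_support[OF T r(2)] h_def pmf_map_snd_eq_sum[of C])
  qed
  \<comment> \<open>\<open>eta\<close> is known to be continuous only on \<open>{0..}\<close>, so
    the nonnegativity of the entries on \<open>F\<close> enters here.\<close>
  have "continuous_on F h"
    unfolding h_def
  proof (intro continuous_on_sum continuous_on_compose2[OF continuous_on_eta])
    show "continuous_on F (\<lambda>M. M (z, w))" for z w
      by (rule continuous_on_subset[OF continuous_on_product_coordinates]) simp
    show "(\<lambda>M. \<Sum>z\<in>C. M (z, w)) ` F \<subseteq> {0..}" for w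
      using F_nonneg by (auto intro!: sum_nonneg)
  qed
  moreover have "F \<noteq> {}" using F_pmf[OF r1] by auto
  ultimately obtain M where M: "M \<in> F" "\<And>M'. M' \<in> F \<Longrightarrow> h M \<le> h M'"
    using continuous_attains_inf[OF \<open>compact F\<close>] by blast
  have M_out: "M (z, w) = 0" if "z \<notin> C \<or> w \<notin> T" for z w
  proof -
    have "M (z, w) \<in> K (z, w)" using M(1) unfolding F_def by blast
    with that show ?thesis by (auto simp: K_def)
  qed
  have M_sum: "(\<Sum>w\<in>T. M (z, w)) = pmf p z" for z
    using M(1) unfolding F_def by blast
  have "\<exists>r. \<forall>x. pmf r x = M x"
  proof (rule ex_pmf_eq_finite_support)
    show "0 \<le> M x" for x
      using M(1) by (rule F_nonneg)
    show "M x = 0" if "x \<notin> C \<times> T" for x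
      using that M_out by (cases x) auto
    show "(\<Sum>x\<in>C \<times> T. M x) = 1"
      using C by (simp add: sum.cartesian_product' M_sum sum_pmf_eq_1)
  qed (use C T in auto)
  then obtain r0 where r0: "pmf r0 = M" by blast
  have supp: "set_pmf (map_pmf snd r0) \<subseteq> T"
    using M_out by (force simp: set_pmf_iff r0)
  have "map_pmf fst r0 = p"
    by (rule pmf_eqI) (simp add: pmf_map_fst_eq_sum[OF T supp] r0 M_sum)
  moreover have "markov r0"
    using M(1) by (auto simp: markov_iff_minors r0 F_def)
  ultimately have r0_in: "r0 \<in> markov_couplings p"
    by (simp add: markov_couplings_def)
  show ?thesis
    using r0_in supp M(2) F_pmf
    by (intro bexI[of _ r0]) (auto simp: h_pmf r0 intro!: ennreal_leI)
qed

section \<open>Truncating an infinite alphabet\<close>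

text \<open>The sum type keeps the retained values of W apart from the substituted values of (X, Y),
  so no retained atom gains mass.\<close>

definition truncate_coupling :: "nat \<Rightarrow> ('z \<times> nat) pmf \<Rightarrow> ('z \<times> (nat + 'z)) pmf" where
  "truncate_coupling N r = map_pmf (\<lambda>(z, w). (z, if w < N then Inl w else Inr z)) r"

lemma pmf_truncate_coupling_Inl:
  "pmf (truncate_coupling N r) (z, Inl w) = (if w < N then pmf r (z, w) else 0)"
proof -
  have "(\<lambda>(z, w). (z, if w < N then Inl w else Inr z)) -` {(z, Inl w :: nat + 'a)} =
      (if w < N then {(z, w)} else {})"
    by (auto split: if_splits)
  then show ?thesis
    by (simp add: truncate_coupling_def pmf_map measure_pmf_single)
qed

lemma pmf_truncate_coupling_Inr:
  "pmf (truncate_coupling N r) (z, Inr z') =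
    (if z = z' then measure r ({z} \<times> {N..}) else 0)"
proof -
  have "(\<lambda>(z, w). (z, if w < N then Inl w else Inr z)) -` {(z, Inr z' :: nat + 'a)} =
      (if z = z' then {z} \<times> {N..} else {})"
    by (auto split: if_splits)
  then show ?thesis
    by (simp add: truncate_coupling_def pmf_map)
qed

text \<open>The matrix at \<open>Inl w\<close> is the old one or zero. The matrix at
  \<open>Inr z\<close> has at most one nonzero entry, so its minors vanish.\<close>

lemma truncate_coupling_markov_couplings:
  assumes "r \<in> markov_couplings p"
  shows "truncate_coupling N r \<in> markov_couplings p"
proof -
  have "map_pmf fst (truncate_coupling N r) = map_pmf fst r"
    unfolding truncate_coupling_def map_pmf_comp by (intro map_pmf_cong) auto
  moreover have "markov (truncate_coupling N r)"
    unfolding markov_iff_minors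
  proof (intro allI)
    fix v :: "nat + 'a \<times> 'b" and x x' y y'
    show "pmf (truncate_coupling N r) ((x, y), v) * pmf (truncate_coupling N r) ((x', y'), v) =
      pmf (truncate_coupling N r) ((x, y'), v) * pmf (truncate_coupling N r) ((x', y), v)"
      using assms
      by (cases v) (auto simp: pmf_truncate_coupling_Inl pmf_truncate_coupling_Inr
          markov_couplings_def markov_iff_minors)
  qed
  ultimately show ?thesis
    using assms by (simp add: markov_couplings_def)
qed

text \<open>The atoms \<open>Inl w\<close> with \<open>w < N\<close> keep their probabilities and
  contribute a partial sum of the old entropy; the error term is exactly the contribution of the
  atoms \<open>Inr z\<close>.\<close>

lemma
  assumes C: "finite C" "set_pmf (map_pmf fst r) \<subseteq> C"
  shows set_truncate_coupling_subset: "set_pmf (map_pmf snd (truncate_coupling N r)) \<subseteq> {..<N} <+> C"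
    and pmf_entropy_truncate_coupling_le: "pmf_entropy (map_pmf snd (truncate_coupling N r)) \<le>
      pmf_entropy (map_pmf snd r) + ennreal (\<Sum>z\<in>C. eta (measure r ({z} \<times> {N..})))"
proof -
  let ?r = "truncate_coupling N r"
  show supp: "set_pmf (map_pmf snd ?r) \<subseteq> {..<N} <+> C"
    using C(2) by (auto simp: truncate_coupling_def split: if_splits)
  have fst_r: "map_pmf fst ?r = map_pmf fst r"
    unfolding truncate_coupling_def map_pmf_comp by (intro map_pmf_cong) auto
  have Inl: "pmf (map_pmf snd ?r) (Inl w) = pmf (map_pmf snd r) w" if "w < N" for w
    using that C fst_r by (simp add: pmf_map_snd_eq_sum[of C] pmf_truncate_coupling_Inl)
  have Inr: "pmf (map_pmf snd ?r) (Inr z) = measure r ({z} \<times> {N..})" if "z \<in> C" for z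
    using that C fst_r by (simp add: pmf_map_snd_eq_sum[of C] pmf_truncate_coupling_Inr)
  have "pmf_entropy (map_pmf snd ?r) = ennreal (\<Sum>v\<in>{..<N} <+> C. eta (pmf (map_pmf snd ?r) v))"
    using C supp by (intro pmf_entropy_finite_support) auto
  also have "\<dots> = ennreal ((\<Sum>w<N. eta (pmf (map_pmf snd r) w)) +
      (\<Sum>z\<in>C. eta (measure r ({z} \<times> {N..}))))"
    using C by (simp add: sum.Plus Inl Inr)
  also have "\<dots> = ennreal (\<Sum>w<N. eta (pmf (map_pmf snd r) w)) +
      ennreal (\<Sum>z\<in>C. eta (measure r ({z} \<times> {N..})))"
    by (intro ennreal_plus sum_nonneg eta_nonneg) (auto simp: pmf_le_1)
  also have "\<dots> \<le> pmf_entropy (map_pmf snd r) + ennreal (\<Sum>z\<in>C. eta (measure r ({z} \<times> {N..})))"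
    by (intro add_right_mono pmf_entropy_ge_partial_sum) simp
  finally show "pmf_entropy (map_pmf snd ?r) \<le>
      pmf_entropy (map_pmf snd r) + ennreal (\<Sum>z\<in>C. eta (measure r ({z} \<times> {N..})))" .
qed

text \<open>For each \<open>z\<close> the tail events decrease to the empty set, and
  \<open>eta\<close> is continuous at 0 with value 0. The error depends on tail masses alone, so an
  infinite entropy of W causes no trouble.\<close>

lemma truncation_error_tendsto_0:
  "(\<lambda>N. ennreal (\<Sum>z\<in>C. eta (measure (measure_pmf r) ({z} \<times> {N::nat..})))) \<longlonglongrightarrow> 0"
proof -
  have "(\<lambda>N. eta (measure r ({z} \<times> {N..}))) \<longlonglongrightarrow> 0" for z
  proof -
    have "(\<lambda>N. measure r ({z} \<times> {N..})) \<longlonglongrightarrow> measure r (\<Inter>N::nat. {z} \<times> {N..})"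
      by (intro measure_pmf.finite_Lim_measure_decseq) (auto simp: decseq_def)
    also have "(\<Inter>N::nat. {z} \<times> {N..}) = {}"
    proof (rule equals0I)
      fix x assume "x \<in> (\<Inter>N::nat. {z} \<times> {N..})"
      then have "x \<in> {z} \<times> {Suc (snd x)..}" by (rule INT_D) simp
      then show False by auto
    qed
    finally have "(\<lambda>N. measure r ({z} \<times> {N..})) \<longlonglongrightarrow> 0" by simp
    from continuous_on_tendsto_compose[OF continuous_on_eta this] show ?thesis by simp
  qed
  then have "(\<lambda>N. \<Sum>z\<in>C. eta (measure r ({z} \<times> {N..}))) \<longlonglongrightarrow> 0"
    by (intro tendsto_null_sum)
  then show ?thesis
    using tendsto_ennrealI by fastforce
qed

section \<open>Equality of the restricted and unrestricted minima\<close>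

theorem proposition5:
  fixes p :: "('a \<times> 'b) pmf" and A :: "'a set" and B :: "'b set"
  assumes "finite A" and "finite B" and "set_pmf p \<subseteq> A \<times> B"
  shows "is_minimum (common_entropy p) (entropy_values p)
    \<and> is_minimum (common_entropy p) (entropy_values_card_le (card A * card B) p)"
proof -
  define C where "C = A \<times> B"
  define n where "n = card C"
  have C: "finite C" "set_pmf p \<subseteq> C"
    using assms by (auto simp: C_def)
  let ?V = "entropy_values_card_le n p"
  \<comment> \<open>Truncation makes the alphabet finite at the cost of the error term; support
    reduction then brings it down to \<open>n\<close> values at no further cost.\<close>
  have approx: "\<exists>h\<in>?V. h \<le> pmf_entropy (map_pmf snd r) + ennreal (\<Sum>z\<in>C. eta (measure r ({z} \<times> {N..})))"
    if r: "r \<in> markov_couplings p" for r :: "(('a \<times> 'b) \<times> nat) pmf" and N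
  proof -
    have supp: "set_pmf (map_pmf fst r) \<subseteq> C"
      using r C by (simp add: markov_couplings_def)
    have fin: "finite (set_pmf (map_pmf snd (truncate_coupling N r)))"
      using set_truncate_coupling_subset[OF C(1) supp] C(1)
      by (meson finite_Plus finite_lessThan finite_subset)
    obtain r' :: "(('a \<times> 'b) \<times> (nat + 'a \<times> 'b)) pmf" where
        r': "r' \<in> markov_couplings p" "finite (set_pmf (map_pmf snd r'))"
        "card (set_pmf (map_pmf snd r')) \<le> n"
        "pmf_entropy (map_pmf snd r') \<le> pmf_entropy (map_pmf snd (truncate_coupling N r))"
      using markov_coupling_support_reduction[OF truncate_coupling_markov_couplings[OF r] C fin]
      unfolding n_def by blast
    have "pmf_entropy (map_pmf snd r') \<in> ?V"
      using r' by (intro pmf_entropy_in_entropy_values_card_le[OF r'(1)]) auto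
    with order_trans[OF r'(4) pmf_entropy_truncate_coupling_le[OF C(1) supp]] show ?thesis
      by blast
  qed
  \<comment> \<open>The alphabet \<open>S\<close> varies with the value \<open>h\<close>. Moving
    every such alphabet into the one set \<open>{..<n}\<close> lets a single compactness argument
    cover all of \<open>?V\<close>.\<close>
  have relabel: "\<exists>r\<in>markov_couplings p. set_pmf (map_pmf snd r) \<subseteq> {..<n} \<and>
      pmf_entropy (map_pmf snd r) = h" if h: "h \<in> ?V" for h
  proof -
    obtain r :: "(('a \<times> 'b) \<times> nat) pmf" and S where r: "r \<in> markov_couplings p"
        "set_pmf (map_pmf snd r) \<subseteq> S" "finite S" "card S \<le> n" "h = pmf_entropy (map_pmf snd r)"
      using h unfolding entropy_values_card_le_def by blast
    let ?f = "to_nat_on S"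
    have bij: "bij_betw ?f S {..<card S}"
      using r(3) by (rule to_nat_on_finite)
    then have inj: "inj_on ?f (set_pmf (map_pmf snd r))"
      using r(2) by (meson bij_betw_imp_inj_on inj_on_subset)
    have eq: "map_pmf snd (map_pmf (map_prod id ?f) r) = map_pmf ?f (map_pmf snd r)"
      by (simp add: map_pmf_comp)
    have "?f ` set_pmf (map_pmf snd r) \<subseteq> ?f ` S"
      using r(2) by (rule image_mono)
    also have "\<dots> \<subseteq> {..<n}"
      using bij_betw_imp_surj_on[OF bij] r(4) by simp
    finally show ?thesis
      using markov_couplings_relabel[OF r(1) inj] pmf_entropy_map_inj_on[OF inj] r(5) eq
      by (intro bexI[of _ "map_pmf (map_prod id ?f) r"]) auto
  qed
  have "\<exists>m. is_minimum m ?V"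
  proof -
    \<comment> \<open>The choice W = (X, Y) shows that \<open>?V\<close> is nonempty: its alphabet
      fits in \<open>C\<close>, which has \<open>n\<close> elements.\<close>
    define r :: "(('a \<times> 'b) \<times> ('a \<times> 'b)) pmf" where "r = map_pmf (\<lambda>z. (z, z)) p"
    have diag: "pmf r (z, w) = 0" if "z \<noteq> w" for z w
      using that by (auto simp: r_def pmf_eq_0_set_pmf)
    have "markov r"
      unfolding markov_iff_minors
    proof (intro allI)
      fix w x y x' y'
      show "pmf r ((x, y), w) * pmf r ((x', y'), w) = pmf r ((x, y'), w) * pmf r ((x', y), w)"
      proof (cases "x = x' \<or> y = y'")
        \<comment> \<open>Here each product contains an off-diagonal entry, because \<open>w\<close>
          cannot equal two different pairs.\<close>
        case False
        then have "pmf r ((x, y), w) = 0 \<or> pmf r ((x', y'), w) = 0"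
            "pmf r ((x, y'), w) = 0 \<or> pmf r ((x', y), w) = 0"
          using diag by (metis prod.inject)+
        then show ?thesis by auto
      qed (auto simp: mult.commute)
    qed
    moreover have "map_pmf fst r = p" "map_pmf snd r = p"
      by (simp_all add: r_def map_pmf_comp)
    ultimately have "r \<in> markov_couplings p" "set_pmf (map_pmf snd r) \<subseteq> C"
      using C by (auto simp: markov_couplings_def)
    then have "pmf_entropy (map_pmf snd r) \<in> ?V"
      using C by (intro pmf_entropy_in_entropy_values_card_le[where S = C]) (auto simp: n_def)
    then obtain r1 :: "(('a \<times> 'b) \<times> nat) pmf" where "r1 \<in> markov_couplings p"
        "set_pmf (map_pmf snd r1) \<subseteq> {..<n}"
      using relabel by blast
    from ex_min_entropy_coupling_on_finite_alphabet[OF C _ this] obtain r0 where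
      r0: "r0 \<in> markov_couplings p" "set_pmf (map_pmf snd r0) \<subseteq> {..<n}"
      "\<And>r. r \<in> markov_couplings p \<Longrightarrow> set_pmf (map_pmf snd r) \<subseteq> {..<n} \<Longrightarrow>
        pmf_entropy (map_pmf snd r0) \<le> pmf_entropy (map_pmf snd r)"
      by blast
    have "pmf_entropy (map_pmf snd r0) \<in> ?V"
      using r0 by (intro pmf_entropy_in_entropy_values_card_le[where S = "{..<n}"]) auto
    moreover have "pmf_entropy (map_pmf snd r0) \<le> h" if "h \<in> ?V" for h
      using relabel[OF that] r0(3) by blast
    ultimately show ?thesis unfolding is_minimum_def by blast
  qed
  then obtain m where m: "m \<in> ?V" "\<And>h. h \<in> ?V \<Longrightarrow> m \<le> h"
    unfolding is_minimum_def by blast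
  have m_in: "m \<in> entropy_values p"
    using m(1) unfolding entropy_values_card_le_def entropy_values_def by blast
  have m_le: "m \<le> h" if "h \<in> entropy_values p" for h
  proof -
    obtain r :: "(('a \<times> 'b) \<times> nat) pmf" where
      r: "r \<in> markov_couplings p" "h = pmf_entropy (map_pmf snd r)"
      using \<open>h \<in> entropy_values p\<close> unfolding entropy_values_def by blast
    \<comment> \<open>Since \<open>m\<close> is already a minimum of \<open>?V\<close>, the bound
      holds for every \<open>N\<close> with the same \<open>m\<close>, and only the error term has
      to pass to the limit.\<close>
    have "m \<le> h + ennreal (\<Sum>z\<in>C. eta (measure r ({z} \<times> {N..})))" for N
      using approx[OF r(1), of N] m(2) r(2) order_trans by blast
    moreover have "(\<lambda>N. h + ennreal (\<Sum>z\<in>C. eta (measure r ({z} \<times> {N..})))) \<longlonglongrightarrow> h + 0"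
      by (intro tendsto_add tendsto_const truncation_error_tendsto_0)
    ultimately show ?thesis
      by (intro LIMSEQ_le_const) auto
  qed
  \<comment> \<open>\<open>LEAST\<close> is determined because the lower bound \<open>m\<close> is
    itself an achievable value.\<close>
  have "common_entropy p = m"
    unfolding common_entropy_def using m_in m_le by (intro Least_equality) auto
  moreover have "n = card A * card B"
    by (simp add: n_def C_def card_cartesian_product)
  ultimately show ?thesis
    using m m_in m_le by (auto simp: is_minimum_def)
qed

end
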